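(* Suppose $\alpha\in BV[a,b]$ and $f\in BV[a,b]$. Then $f\in RDS_\alpha[a,b]$.
   Context: Fix reals $a<b$. $B[a,b]$, $I[a,b]$, $BV[a,b]$ denote the bounded, the increasing (nondecreasing), and the bounded-variation real functions on $[a,b]$. $\alpha(x\pm)$ are one-sided limits, with the convention $\alpha(a-)=\alpha(a)$, $\alpha(b+)=\alpha(b)$. A partition is $\mathcal P=\{x_i\}_{i=0}^n$ with $a=x_0<\dots<x_n=b$; $I_i=(x_{i-1},x_i)$. Set $\mu_\alpha((c,d))=\alpha(d-)-\alpha(c+)$ and $\mu_\alpha(\{c\})=\alpha(c+)-\alpha(c-)$. A step function $u\in S[a,b]$ is a bounded function which, for some partition, equals a constant $c_i$ on each $I_i$ (values at partition points arbitrary); its integral is $\int_a^b u\,d\alpha=\sum_{i=0}^n u(x_i)\mu_\alpha(\{x_i\})+\sum_{i=1}^n c_i\mu_\alpha(I_i)$ (independent of the partition). RDS integral: for $\alpha\in I[a,b]$, $f\in B[a,b]$, let $L_\alpha(f,[a,b])=\sup\{\int_a^b v\,d\alpha: v\in S[a,b], v\le f\}$ and $U_\alpha(f,[a,b])=\inf\{\int_a^b u\,d\alpha: u\in S[a,b], u\ge f\}$. Write $f\in RDS_\alpha[a,b]$ if these are equal; the common value is $\int_a^b f(x)\,d\alpha$. For $\alpha\in BV[a,b]$, $f\in RDS_\alpha[a,b]$ if there is a decomposition $\alpha=\alpha^+-\alpha^-$ with $\alpha^\pm\in I[a,b]$ and $f\in RDS_{\alpha^+}[a,b]\cap RDS_{\alpha^-}[a,b]$.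 *)

theory Defs
  imports "HOL-Analysis.Analysis"
begin

text \<open>
  Functions on \<open>[a, b]\<close> are represented by total functions on the reals; every notion below
  depends only on their values on \<open>{a..b}\<close>.
\<close>

definition is_partition :: "real \<Rightarrow> real \<Rightarrow> nat \<Rightarrow> (nat \<Rightarrow> real) \<Rightarrow> bool" where
  "is_partition a b n x \<longleftrightarrow> x 0 = a \<and> x n = b \<and> (\<forall>i\<in>{1..n}. x (i - 1) < x i)"

definition bounded_fun_on :: "real \<Rightarrow> real \<Rightarrow> (real \<Rightarrow> real) \<Rightarrow> bool" where
  "bounded_fun_on a b f \<longleftrightarrow> bounded (f ` {a..b})"

definition bounded_variation_on :: "real \<Rightarrow> real \<Rightarrow> (real \<Rightarrow> real) \<Rightarrow> bool" where
  "bounded_variation_on a b f \<longleftrightarrow>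
     (\<exists>M. \<forall>n x. is_partition a b n x \<longrightarrow> (\<Sum>i=1..n. \<bar>f (x i) - f (x (i - 1))\<bar>) \<le> M)"

text \<open>
  One-sided limits of \<open>\<alpha>\<close>, with the endpoint conventions \<open>\<alpha>(a-) = \<alpha>(a)\<close> and \<open>\<alpha>(b+) = \<alpha>(b)\<close>.
  \<^const>\<open>Lim\<close> is a definite description; below it is only applied to \<open>\<alpha>\<close> nondecreasing on
  \<open>[a, b]\<close> and points of \<open>[a, b]\<close>, where the limits exist.
\<close>

definition left_lim :: "real \<Rightarrow> (real \<Rightarrow> real) \<Rightarrow> real \<Rightarrow> real" where
  "left_lim a \<alpha> c = (if c = a then \<alpha> a else Lim (at_left c) \<alpha>)"

definition right_lim :: "real \<Rightarrow> (real \<Rightarrow> real) \<Rightarrow> real \<Rightarrow> real" where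
  "right_lim b \<alpha> c = (if c = b then \<alpha> b else Lim (at_right c) \<alpha>)"

definition mu_open :: "real \<Rightarrow> real \<Rightarrow> (real \<Rightarrow> real) \<Rightarrow> real \<Rightarrow> real \<Rightarrow> real" where
  "mu_open a b \<alpha> c d = left_lim a \<alpha> d - right_lim b \<alpha> c"

definition mu_point :: "real \<Rightarrow> real \<Rightarrow> (real \<Rightarrow> real) \<Rightarrow> real \<Rightarrow> real" where
  "mu_point a b \<alpha> c = right_lim b \<alpha> c - left_lim a \<alpha> c"

definition step_on_partition ::
  "real \<Rightarrow> real \<Rightarrow> nat \<Rightarrow> (nat \<Rightarrow> real) \<Rightarrow> (nat \<Rightarrow> real) \<Rightarrow> (real \<Rightarrow> real) \<Rightarrow> bool" where
  "step_on_partition a b n x c u \<longleftrightarrow>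
     bounded_fun_on a b u \<and> is_partition a b n x \<and>
     (\<forall>i\<in>{1..n}. \<forall>t\<in>{x (i - 1)<..<x i}. u t = c i)"

text \<open>
  \<open>has_step_integral a b \<alpha> u I\<close> says that \<open>u\<close> is a step function on \<open>[a, b]\<close> whose integral
  against \<open>\<alpha>\<close> is \<open>I\<close>.  The sum does not depend on the chosen partition, so for nondecreasing
  \<open>\<alpha>\<close> a step function \<open>u\<close> has exactly one such \<open>I\<close>.
\<close>

definition has_step_integral ::
  "real \<Rightarrow> real \<Rightarrow> (real \<Rightarrow> real) \<Rightarrow> (real \<Rightarrow> real) \<Rightarrow> real \<Rightarrow> bool" where
  "has_step_integral a b \<alpha> u I \<longleftrightarrow>
     (\<exists>n x c. step_on_partition a b n x c u \<and>
        I = (\<Sum>i=0..n. u (x i) * mu_point a b \<alpha> (x i))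
          + (\<Sum>i=1..n. c i * mu_open a b \<alpha> (x (i - 1)) (x i)))"

text \<open>
  For \<open>a < b\<close>, \<open>\<alpha>\<close> nondecreasing and \<open>f\<close> bounded on \<open>[a, b]\<close>, the sets below are nonempty and
  bounded above, respectively below, so \<^const>\<open>Sup\<close> and \<^const>\<open>Inf\<close> on the reals are the genuine
  supremum and infimum.
\<close>

definition lower_rds :: "real \<Rightarrow> real \<Rightarrow> (real \<Rightarrow> real) \<Rightarrow> (real \<Rightarrow> real) \<Rightarrow> real" where
  "lower_rds a b \<alpha> f = Sup {I. \<exists>v. has_step_integral a b \<alpha> v I \<and> (\<forall>t\<in>{a..b}. v t \<le> f t)}"

definition upper_rds :: "real \<Rightarrow> real \<Rightarrow> (real \<Rightarrow> real) \<Rightarrow> (real \<Rightarrow> real) \<Rightarrow> real" where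
  "upper_rds a b \<alpha> f = Inf {I. \<exists>u. has_step_integral a b \<alpha> u I \<and> (\<forall>t\<in>{a..b}. f t \<le> u t)}"

definition rds_integrable_incr :: "real \<Rightarrow> real \<Rightarrow> (real \<Rightarrow> real) \<Rightarrow> (real \<Rightarrow> real) \<Rightarrow> bool" where
  "rds_integrable_incr a b \<alpha> f \<longleftrightarrow>
     mono_on {a..b} \<alpha> \<and> bounded_fun_on a b f \<and> lower_rds a b \<alpha> f = upper_rds a b \<alpha> f"

text \<open>RDS integrability for an integrator \<open>\<alpha>\<close> of bounded variation.\<close>

definition rds_integrable :: "real \<Rightarrow> real \<Rightarrow> (real \<Rightarrow> real) \<Rightarrow> (real \<Rightarrow> real) \<Rightarrow> bool" where
  "rds_integrable a b \<alpha> f \<longleftrightarrow>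
     (\<exists>\<alpha>p \<alpha>m. mono_on {a..b} \<alpha>p \<and> mono_on {a..b} \<alpha>m \<and> (\<forall>t\<in>{a..b}. \<alpha> t = \<alpha>p t - \<alpha>m t) \<and>
        rds_integrable_incr a b \<alpha>p f \<and> rds_integrable_incr a b \<alpha>m f)"

end

theory Submission
  imports Defs
begin

text \<open>
  The variation function \<open>V\<close> of \<open>f\<close> dominates the increments of \<open>f\<close>, and the finitely many points
  where \<open>V\<close> crosses a multiple of \<open>\<epsilon>\<close> cut \<open>[a, b]\<close> into open intervals on which \<open>f\<close> oscillates by at
  most \<open>\<epsilon>\<close>.  So \<open>f\<close> is within \<open>\<epsilon>\<close> of a step function \<open>w\<close>, and for nondecreasing \<open>\<alpha>\<close> the integrals of
  \<open>w - \<epsilon> \<le> f \<le> w + \<epsilon>\<close> differ by \<open>2\<epsilon>(\<alpha>(b) - \<alpha>(a))\<close>.  An integrator of bounded variation is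
  the difference of its own variation function and another nondecreasing function.
\<close>

section \<open>Partitions\<close>

lemma is_partition_extend:
  assumes "is_partition a s n x" "s < t"
  shows "is_partition a t (Suc n) (x(Suc n := t))"
proof -
  have "(x(Suc n := t)) (i - 1) < (x(Suc n := t)) i" if "i \<in> {1..Suc n}" for i
    using assms that by (cases "i = Suc n") (auto simp: is_partition_def)
  then show ?thesis using assms by (simp add: is_partition_def)
qed

lemma is_partition_step:
  assumes "is_partition a b n x" "i < n"
  shows "x i < x (Suc i)"
proof -
  have "Suc i \<in> {1..n}" using assms(2) by simp
  then have "x (Suc i - 1) < x (Suc i)"
    using assms(1) unfolding is_partition_def by blast
  then show ?thesis by simp
qed

lemma is_partition_less:
  assumes "is_partition a b n x" "i < j" "j \<le> n"
  shows "x i < x j"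
  using assms(2,3)
proof (induction j)
  case (Suc j)
  then have "x j < x (Suc j)"
    using assms(1) by (intro is_partition_step) auto
  with Suc show ?case by (cases "i = j") auto
qed simp

lemma is_partition_le:
  assumes "is_partition a b n x" "i \<le> j" "j \<le> n"
  shows "x i \<le> x j"
  using is_partition_less[OF assms(1), of i j] assms(2,3) by (cases "i = j") auto

lemma is_partition_mem:
  assumes "is_partition a b n x" "i \<le> n"
  shows "x i \<in> {a..b}"
  using is_partition_le[OF assms(1), of 0 i] is_partition_le[OF assms(1), of i n] assms
  by (auto simp: is_partition_def)

section \<open>The variation function\<close>

text \<open>\<open>V t\<close> is the supremum of the variation sums over partitions of [a, t].
  Appending t to a partition of [a, s] adds exactly the increment of f from s to t, so the supremum
  grows by at least that much.\<close>

lemma bounded_variation_on_majorant: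
  assumes "bounded_variation_on a b f"
  obtains V where "\<And>s t. \<lbrakk>a \<le> s; s \<le> t; t \<le> b\<rbrakk> \<Longrightarrow> \<bar>f t - f s\<bar> \<le> V t - V s"
proof -
  define S where "S x n = (\<Sum>i=1..n. \<bar>f (x i) - f (x (i - 1))\<bar>)" for x :: "nat \<Rightarrow> real" and n
  define A where "A t = {S x n | x n. is_partition a t n x}" for t
  obtain M where M: "is_partition a b n x \<Longrightarrow> S x n \<le> M" for n x
    using assms unfolding bounded_variation_on_def S_def by blast
  have ext: "S (x(Suc n := t)) (Suc n) = S x n + \<bar>f t - f s\<bar>" if "is_partition a s n x" for x n s t
  proof -
    have "S (x(Suc n := t)) n = S x n"
      unfolding S_def by (intro sum.cong) auto
    then show ?thesis
      using that by (simp add: S_def is_partition_def)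
  qed
  have ub: "y \<le> M" if y: "y \<in> A t" and "t \<le> b" for y t
  proof -
    obtain x n where xn: "y = S x n" "is_partition a t n x"
      using y unfolding A_def by blast
    \<comment> \<open>For t < b the partition is completed by the point b, which can only enlarge
      the sum, so M bounds it too.\<close>
    show ?thesis
    proof (cases "t = b")
      case False
      then have "S (x(Suc n := b)) (Suc n) \<le> M"
        using xn that by (intro M is_partition_extend) auto
      then show ?thesis
        using ext[OF xn(2), of b] xn by linarith
    qed (use xn M in simp)
  qed
  have ne: "A t \<noteq> {}" if "a \<le> t" for t
  proof (cases "t = a")
    case True
    have "is_partition a a 0 (\<lambda>_. a)" by (simp add: is_partition_def)
    then show ?thesis using True unfolding A_def by blast
  next
    case False
    then have "is_partition a t (Suc 0) ((\<lambda>_. a)(Suc 0 := t))"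
      using that by (simp add: is_partition_def)
    then show ?thesis unfolding A_def by blast
  qed
  have "\<bar>f t - f s\<bar> \<le> Sup (A t) - Sup (A s)" if "a \<le> s" "s \<le> t" "t \<le> b" for s t
  proof (cases "s = t")
    case False
    have bdd: "bdd_above (A t)" using ub that by (meson bdd_aboveI)
    have "Sup (A s) \<le> Sup (A t) - \<bar>f t - f s\<bar>"
    proof (rule cSup_least)
      fix y assume "y \<in> A s"
      then obtain x n where xn: "y = S x n" "is_partition a s n x"
        unfolding A_def by blast
      have "S (x(Suc n := t)) (Suc n) \<in> A t"
        using is_partition_extend[OF xn(2), of t] that False unfolding A_def by auto
      then have "S (x(Suc n := t)) (Suc n) \<le> Sup (A t)"
        using bdd by (rule cSup_upper)
      then show "y \<le> Sup (A t) - \<bar>f t - f s\<bar>"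
        using ext[OF xn(2), of t] xn by linarith
    qed (use ne that in auto)
    then show ?thesis by linarith
  qed simp
  then show ?thesis by (rule that)
qed

section \<open>Uniform approximation by step functions\<close>

text \<open>The set consists of the points where V reaches the levels \<open>V a + j * e\<close>. If
  V grows by more than e from s to t, it passes such a level in [s, t].\<close>

lemma mono_on_finite_separating_set:
  fixes V :: "real \<Rightarrow> real"
  assumes V: "mono_on {a..b} V" and "e > 0"
  obtains F where "finite F"
    "\<And>s t. \<lbrakk>a \<le> s; s \<le> t; t \<le> b; {s..t} \<inter> F = {}\<rbrakk> \<Longrightarrow> V t - V s \<le> e"
proof
  define p where "p j = Inf {t \<in> {a..b}. V t \<ge> V a + real j * e}" for j :: nat
  define N where "N = nat \<lfloor>(V b - V a) / e\<rfloor>"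
  show "finite (p ` {..N})" by simp
  fix s t assume st: "a \<le> s" "s \<le> t" "t \<le> b" and disj: "{s..t} \<inter> p ` {..N} = {}"
  show "V t - V s \<le> e"
  proof (rule ccontr)
    assume neg: "\<not> V t - V s \<le> e"
    \<comment> \<open>The last level at or below \<open>V t\<close>: it is less than e under
      \<open>V t\<close>, hence strictly above \<open>V s\<close>, so V reaches it neither before s
      nor later than t.\<close>
    define j where "j = nat \<lfloor>(V t - V a) / e\<rfloor>"
    have mono: "V a \<le> V s" "V s \<le> V t" "V t \<le> V b"
      using V st by (auto simp: mono_on_def)
    have "j \<le> N"
      unfolding j_def N_def using mono \<open>e > 0\<close>
      by (intro nat_mono floor_mono divide_right_mono) auto
    have "(V t - V a) / e \<ge> 0" using mono \<open>e > 0\<close> by simp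
    then have "real j \<le> (V t - V a) / e" "(V t - V a) / e < real j + 1"
      unfolding j_def by linarith+
    then have j: "V a + real j * e \<le> V t" "V t < V a + real j * e + e"
      using \<open>e > 0\<close> by (auto simp: field_simps)
    have "p j \<le> t"
      unfolding p_def using st j by (intro cInf_lower bdd_belowI[of _ a]) auto
    moreover have "s \<le> p j"
      unfolding p_def
    proof (rule cInf_greatest)
      show "{t \<in> {a..b}. V a + real j * e \<le> V t} \<noteq> {}" using st j by auto
      fix r assume r: "r \<in> {t \<in> {a..b}. V a + real j * e \<le> V t}"
      show "s \<le> r"
      proof (rule ccontr)
        assume "\<not> s \<le> r"
        then have "V r \<le> V s" using V r st by (auto simp: mono_on_def)
        then show False using r j neg by auto
      qed
    qed
    ultimately show False using disj \<open>j \<le> N\<close> by auto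
  qed
qed

text \<open>The partition is the sorted list of a, b and the points of F in [a, b]; neighbours in it
  have no further entry between them.\<close>

lemma is_partition_of_finite_set:
  assumes "finite F" "a \<le> b"
  obtains n x where "is_partition a b n x"
    "\<And>i. i \<in> {1..n} \<Longrightarrow> {x (i - 1)<..<x i} \<inter> F = {}"
proof -
  define G where "G = {a, b} \<union> (F \<inter> {a..b})"
  define xs where "xs = sorted_list_of_set G"
  have G: "finite G" "G \<subseteq> {a..b}" "a \<in> G" "b \<in> G"
    using assms by (auto simp: G_def)
  have xs: "set xs = G" "sorted xs" "distinct xs"
    using G by (auto simp: xs_def)
  define n where "n = length xs - 1"
  have len: "length xs = Suc n"
    using xs G by (cases xs) (auto simp: n_def)
  have lt: "xs ! i < xs ! j" if "i < j" "j \<le> n" for i j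
    using sorted_nth_mono[OF xs(2), of i j] nth_eq_iff_index_eq[OF xs(3), of i j] that len
    by (simp add: order_less_le)
  have le: "xs ! i \<le> xs ! j" if "i \<le> j" "j \<le> n" for i j
    using lt[of i j] that by (cases "i = j") auto
  have mem: "xs ! i \<in> {a..b}" if "i \<le> n" for i
    using xs(1) G that len nth_mem[of i xs] by auto
  obtain i where i: "i \<le> n" "xs ! i = a"
    using xs(1) G len by (metis in_set_conv_nth less_Suc_eq_le)
  obtain j where j: "j \<le> n" "xs ! j = b"
    using xs(1) G len by (metis in_set_conv_nth less_Suc_eq_le)
  have "is_partition a b n (\<lambda>i. xs ! i)"
    unfolding is_partition_def using le[of 0 i] le[of j n] i j mem[of 0] mem[of n] lt by auto
  moreover have "{xs ! (i - 1)<..<xs ! i} \<inter> F = {}" if "i \<in> {1..n}" for i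
  proof (rule ccontr)
    assume "{xs ! (i - 1)<..<xs ! i} \<inter> F \<noteq> {}"
    then obtain p where p: "p \<in> F" "xs ! (i - 1) < p" "p < xs ! i" by auto
    moreover have "i - 1 \<le> n" using that by auto
    moreover from this have "a \<le> xs ! (i - 1)" "xs ! i \<le> b"
      using mem[of i] mem[of "i - 1"] that by simp_all
    ultimately have "p \<in> G" by (simp add: G_def)
    then obtain k where "k \<le> n" "p = xs ! k"
      using xs(1) len by (metis in_set_conv_nth less_Suc_eq_le)
    moreover have "i \<le> k \<or> k \<le> i - 1" by linarith
    ultimately show False
      using p le[of k "i - 1"] le[of i k] \<open>i - 1 \<le> n\<close> by auto
  qed
  ultimately show ?thesis by (rule that)
qed

lemma step_on_partition_shift:
  assumes "step_on_partition a b n x c w"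
  shows "step_on_partition a b n x (\<lambda>i. c i + k) (\<lambda>t. w t + k)"
proof -
  have "bounded ((\<lambda>t. k + t) ` w ` {a..b})"
    using assms by (intro bounded_translation) (simp add: step_on_partition_def bounded_fun_on_def)
  then show ?thesis
    using assms by (auto simp: step_on_partition_def bounded_fun_on_def image_image add.commute)
qed

lemma bounded_fun_on_close:
  assumes "bounded_fun_on a b f" "\<And>t. t \<in> {a..b} \<Longrightarrow> \<bar>w t - f t\<bar> \<le> e"
  shows "bounded_fun_on a b w"
proof -
  obtain M where M: "\<And>t. t \<in> {a..b} \<Longrightarrow> \<bar>f t\<bar> \<le> M"
    using assms(1) unfolding bounded_fun_on_def bounded_iff real_norm_def by blast
  have "\<bar>w t\<bar> \<le> M + e" if "t \<in> {a..b}" for t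
    using M[OF that] assms(2)[OF that] by linarith
  then show ?thesis unfolding bounded_fun_on_def bounded_iff real_norm_def by blast
qed

text \<open>Oscillation has to be controlled only inside the open pieces: at partition points w
  copies f, since a step function may take any values there.\<close>

lemma step_on_partition_approx:
  assumes V: "\<And>s t. \<lbrakk>a \<le> s; s \<le> t; t \<le> b\<rbrakk> \<Longrightarrow> \<bar>f t - f s\<bar> \<le> V t - V s"
    and "a \<le> b" "bounded_fun_on a b f" "e > 0"
  obtains n x c w where "step_on_partition a b n x c w" "\<And>t. t \<in> {a..b} \<Longrightarrow> \<bar>w t - f t\<bar> \<le> e"
proof -
  have "V s \<le> V t" if "a \<le> s" "s \<le> t" "t \<le> b" for s t
    using V[OF that] by linarith
  then have "mono_on {a..b} V" by (simp add: mono_on_def)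
  then obtain F where F: "finite F"
    "\<And>s t. \<lbrakk>a \<le> s; s \<le> t; t \<le> b; {s..t} \<inter> F = {}\<rbrakk> \<Longrightarrow> V t - V s \<le> e"
    using mono_on_finite_separating_set[OF _ \<open>e > 0\<close>] by metis
  obtain n x where x: "is_partition a b n x"
    "\<And>i. i \<in> {1..n} \<Longrightarrow> {x (i - 1)<..<x i} \<inter> F = {}"
    using is_partition_of_finite_set[OF F(1) \<open>a \<le> b\<close>] by metis
  define c where "c i = f ((x (i - 1) + x i) / 2)" for i
  \<comment> \<open>For t in [a, b] off the partition points, this is the number of the open piece
    containing t. The minimum runs over all naturals, also beyond n where x is arbitrary;
    \<open>t \<le> x n\<close> keeps it at most n.\<close>
  define idx where "idx t = (LEAST i. t \<le> x i)" for t
  define w where "w t = (if t \<in> x ` {..n} then f t else c (idx t))" for t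
  have w_open: "w t = c i" if i: "i \<in> {1..n}" and t: "x (i - 1) < t" "t < x i" for i t
  proof -
    have beyond: "i \<le> k" if "k \<le> n" "t \<le> x k" for k
    proof (rule ccontr)
      assume "\<not> i \<le> k"
      then have "k \<le> i - 1" "i - 1 \<le> n" using i by auto
      then show False
        using is_partition_le[OF x(1), of k "i - 1"] that t by simp
    qed
    have "idx t = i"
      unfolding idx_def
    proof (rule Least_equality)
      fix k assume "t \<le> x k"
      then show "i \<le> k" using beyond[of k] i by (cases "k \<le> n") auto
    qed (use t in simp)
    moreover have "t \<notin> x ` {..n}"
    proof
      assume "t \<in> x ` {..n}"
      then obtain k where "k \<le> n" "t = x k" by auto
      then show False
        using beyond[of k] is_partition_le[OF x(1), of i k] t by auto
    qed
    ultimately show ?thesis by (simp add: w_def)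
  qed
  have c_close: "\<bar>c i - f t\<bar> \<le> e" if i: "i \<in> {1..n}" and t: "x (i - 1) < t" "t < x i" for i t
  proof -
    define m where "m = (x (i - 1) + x i) / 2"
    have m: "x (i - 1) < m" "m < x i" using t by (auto simp: m_def)
    have ab: "a \<le> x (i - 1)" "x i \<le> b"
      using is_partition_mem[OF x(1), of i] is_partition_mem[OF x(1), of "i - 1"] i by auto
    have "\<bar>f r - f s\<bar> \<le> e" if "x (i - 1) < s" "s \<le> r" "r < x i" for s r
    proof -
      \<comment> \<open>A closed interval inside an open piece misses F, so V, and with it f,
        changes by at most e.\<close>
      have "{s..r} \<subseteq> {x (i - 1)<..<x i}" using that by auto
      then have "{s..r} \<inter> F = {}" using x(2)[OF i] by blast
      then have "V r - V s \<le> e" using F(2)[of s r] that ab by simp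
      then show ?thesis using V[of s r] that ab by simp
    qed
    from this[of m t] this[of t m] show ?thesis
      using m t by (cases "t \<le> m") (auto simp: c_def m_def[symmetric] simp del: One_nat_def)
  qed
  have close: "\<bar>w t - f t\<bar> \<le> e" if t: "t \<in> {a..b}" for t
  proof (cases "t \<in> x ` {..n}")
    case False
    have "t \<le> x n" using x(1) t by (simp add: is_partition_def)
    then have le: "t \<le> x (idx t)" and least: "\<And>k. t \<le> x k \<Longrightarrow> idx t \<le> k"
      unfolding idx_def by (auto intro: LeastI Least_le)
    have n: "idx t \<le> n" using least \<open>t \<le> x n\<close> by blast
    have "t \<noteq> x (idx t)" using False n by auto
    \<comment> \<open>Index 0 would force t = a, a partition point, which this case excludes; so
      \<open>idx t - 1\<close> is a genuine predecessor.\<close>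
    have "idx t \<noteq> 0"
    proof
      assume "idx t = 0"
      then have "t = x (idx t)" using le t x(1) by (auto simp: is_partition_def)
      then show False using \<open>t \<noteq> x (idx t)\<close> by blast
    qed
    then have "x (idx t - 1) < t"
      using least[of "idx t - 1"] by force
    then show ?thesis
      using c_close[of "idx t" t] w_open[of "idx t" t] le \<open>t \<noteq> x (idx t)\<close> n \<open>idx t \<noteq> 0\<close> by auto
  qed (use \<open>e > 0\<close> in \<open>simp add: w_def\<close>)
  have "bounded_fun_on a b w"
    using bounded_fun_on_close[OF assms(3) close] .
  then have "step_on_partition a b n x c w"
    using x(1) w_open by (simp add: step_on_partition_def)
  then show ?thesis using close by (rule that)
qed

section \<open>Sums of step functions and their comparison\<close>

text \<open>
  The step integral over \<open>[x 0, x n)\<close>, the last point being left out so that sums over adjacent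
  intervals add up; \<open>L\<close> and \<open>R\<close> stand for \<open>\<alpha>(t-)\<close> and \<open>\<alpha>(t+)\<close>.
\<close>

definition step_sum ::
  "(real \<Rightarrow> real) \<Rightarrow> (real \<Rightarrow> real) \<Rightarrow> (real \<Rightarrow> real) \<Rightarrow> nat \<Rightarrow> (nat \<Rightarrow> real) \<Rightarrow> (nat \<Rightarrow> real) \<Rightarrow> real" where
  "step_sum L R u n x c =
     (\<Sum>i<n. u (x i) * (R (x i) - L (x i)) + c (Suc i) * (L (x (Suc i)) - R (x i)))"

lemma step_sum_Suc:
  "step_sum L R u (Suc n) x c =
    step_sum L R u n x c + u (x n) * (R (x n) - L (x n)) + c (Suc n) * (L (x (Suc n)) - R (x n))"
  by (simp add: step_sum_def)

lemma step_sum_uminus: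
  "step_sum L R (\<lambda>t. - u t) n x (\<lambda>i. - c i) = - step_sum L R u n x c"
  by (induction n) (auto simp: step_sum_Suc step_sum_def algebra_simps)

text \<open>The weights of points and open pieces telescope; the right end enters through L because
  the last point is left out.\<close>

lemma step_sum_shift:
  "step_sum L R (\<lambda>t. u t + k) n x (\<lambda>i. c i + k) = step_sum L R u n x c + k * (L (x n) - L (x 0))"
  by (induction n) (auto simp: step_sum_Suc step_sum_def algebra_simps)

lemma step_sum_upd: "step_sum L R u n (x(Suc n := q)) c = step_sum L R u n x c"
  unfolding step_sum_def by (intro sum.cong) auto

definition step_values :: "nat \<Rightarrow> (nat \<Rightarrow> real) \<Rightarrow> (nat \<Rightarrow> real) \<Rightarrow> (real \<Rightarrow> real) \<Rightarrow> bool" where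
  "step_values n x c u \<longleftrightarrow> (\<forall>i\<in>{1..n}. \<forall>t\<in>{x (i - 1)<..<x i}. u t = c i)"

lemma step_values_uminus:
  "step_values n x c u \<Longrightarrow> step_values n x (\<lambda>i. - c i) (\<lambda>t. - u t)"
  by (simp add: step_values_def)

lemma step_values_Suc:
  "step_values (Suc n) x c u \<longleftrightarrow>
     step_values n x c u \<and> (\<forall>t\<in>{x n<..<x (Suc n)}. u t = c (Suc n))"
proof -
  have "{1..Suc n} = insert (Suc n) {1..n}" by auto
  then show ?thesis by (auto simp: step_values_def)
qed

lemma step_values_upd:
  assumes "step_values (Suc n) x c u" "q \<le> x (Suc n)"
  shows "step_values (Suc n) (x(Suc n := q)) c u"
  using assms by (auto simp: step_values_def)

lemma is_partition_Suc:
  assumes "is_partition a b (Suc n) x"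
  shows "is_partition a (x n) n x" "x n < b" "x (Suc n) = b"
proof -
  show "is_partition a (x n) n x"
    using assms by (auto simp: is_partition_def)
  show "x n < b" "x (Suc n) = b"
    using is_partition_step[OF assms, of n] assms by (simp_all add: is_partition_def)
qed

text \<open>
  Instead of forming a common refinement, the proof cuts both sums at the larger of the two
  penultimate partition points and recurses on the part to the left of it; negation exchanges
  the roles of \<open>u\<close> and \<open>v\<close>.
\<close>

lemma step_sum_mono:
  assumes jump: "\<And>p. \<lbrakk>a \<le> p; p \<le> b\<rbrakk> \<Longrightarrow> L p \<le> R p"
    and incr: "\<And>p q. \<lbrakk>a \<le> p; p < q; q \<le> b\<rbrakk> \<Longrightarrow> R p \<le> L q"
    and "is_partition a p n x" "step_values n x c u"
    and "is_partition a p m y" "step_values m y d v"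
    and "p \<le> b" "\<And>t. \<lbrakk>a \<le> t; t < p\<rbrakk> \<Longrightarrow> v t \<le> u t"
  shows "step_sum L R v m y d \<le> step_sum L R u n x c"
  using assms(3-)
\<comment> \<open>Each cut lowers the total number of pieces; p varies because the cut point becomes
  the new right end.\<close>
proof (induction "n + m" arbitrary: p n x c u m y d v rule: less_induct)
  case less
  show ?case
  proof (cases "n = 0 \<or> m = 0")
    case True
    then have "p = a" using less.prems by (auto simp: is_partition_def)
    then have "n = 0" "m = 0"
      using is_partition_less[OF less.prems(1), of 0 n] is_partition_less[OF less.prems(3), of 0 m]
        less.prems by (auto simp: is_partition_def)
    then show ?thesis by (simp add: step_sum_def)
  next
    case False
    then obtain n' m' where n': "n = Suc n'" and m': "m = Suc m'"
      by (meson not0_implies_Suc)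
    \<comment> \<open>The data are generalized and the induction hypothesis is a premise, so that
      this applies once to u, v and once to their negatives in exchanged roles.\<close>
    have swap: "step_sum L R v m y d \<le> step_sum L R u n x c"
      if *: "is_partition a p n x" "step_values n x c u" "is_partition a p m y" "step_values m y d v"
        "\<And>t. \<lbrakk>a \<le> t; t < p\<rbrakk> \<Longrightarrow> v t \<le> u t" "y m' \<le> x n'" "n = Suc n'" "m = Suc m'"
        "n + m = N"
        and IH: "\<And>p n x c u m y d v. \<lbrakk>n + m < N; is_partition a p n x; step_values n x c u;
          is_partition a p m y; step_values m y d v; p \<le> b; \<And>t. \<lbrakk>a \<le> t; t < p\<rbrakk> \<Longrightarrow> v t \<le> u t\<rbrakk>
          \<Longrightarrow> step_sum L R v m y d \<le> step_sum L R u n x c"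
      for n x c u m y d v n' m' and N :: nat
    proof -
      note x = is_partition_Suc[OF *(1)[unfolded \<open>n = Suc n'\<close>]]
        and y = is_partition_Suc[OF *(3)[unfolded \<open>m = Suc m'\<close>]]
      define q where "q = x n'"
      have q: "a \<le> q" "q < p" using is_partition_mem[OF x(1), of n'] x by (auto simp: q_def)
      \<comment> \<open>Such a t lies in the last piece of both partitions, so the inequality at t
        compares the constants \<open>d m\<close> and \<open>c n\<close>.\<close>
      obtain t where t: "q < t" "t < p" using dense[OF q(2)] by blast
      have vu: "v q \<le> u q" using *(5) q by simp
      have cu: "u t = c n" "v t = d m"
        using *(2,4,6) t x y by (auto simp: step_values_Suc q_def \<open>n = Suc n'\<close> \<open>m = Suc m'\<close>)
      have dc: "d m \<le> c n" using cu *(5)[of t] t q by simp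
      \<comment> \<open>Comparison on [q, p): the weights of q and of (q, p) are nonnegative by
        \<open>jump\<close> and \<open>incr\<close>.\<close>
      have last: "v q * (R q - L q) + d m * (L p - R q) \<le> u q * (R q - L q) + c n * (L p - R q)"
        using jump[of q] incr[of q p] q less.prems(5) vu dc
        by (intro add_mono mult_right_mono) auto
      have su: "step_sum L R u n x c = step_sum L R u n' x c + u q * (R q - L q) + c n * (L p - R q)"
        using x by (simp add: \<open>n = Suc n'\<close> step_sum_Suc q_def)
      have sx: "step_values n' x c u" using *(2) by (simp add: \<open>n = Suc n'\<close> step_values_Suc)
      show ?thesis
      proof (cases "y m' = q")
        case True
        have "step_sum L R v m' y d \<le> step_sum L R u n' x c"
          using * x(1) y(1) True q less.prems(5) sx
          by (intro IH[of n' m' q]) (auto simp: q_def step_values_Suc)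
        then show ?thesis
          using su last True y by (simp add: \<open>m = Suc m'\<close> step_sum_Suc)
      next
        case False
        then have yq: "y m' < q" using *(6) by (simp add: q_def)
        \<comment> \<open>Only the u-side loses a piece; the last piece of y is shortened to end at
          q.\<close>
        have "step_sum L R v m (y(m := q)) d \<le> step_sum L R u n' x c"
        proof (rule IH[of n' m q])
          show "is_partition a q m (y(m := q))"
            using is_partition_extend[OF y(1) yq] by (simp add: \<open>m = Suc m'\<close>)
          show "step_values m (y(m := q)) d v"
            using step_values_upd[of m' y d v q] * y q by (simp add: \<open>m = Suc m'\<close>)
        qed (use * x q less.prems(5) sx in \<open>auto simp: q_def\<close>)
        \<comment> \<open>q is interior to the last piece of y, so v equals \<open>d m\<close> at q
          and on both sides, and the weight of that piece splits as
          \<open>(L q - R (y m')) + (R q - L q) + (L p - R q)\<close>.\<close>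
        moreover have "v q = d m"
          using *(4) yq q y by (auto simp: step_values_Suc \<open>m = Suc m'\<close>)
        then have "step_sum L R v m y d =
            step_sum L R v m (y(m := q)) d + v q * (R q - L q) + d m * (L p - R q)"
          using y by (simp add: \<open>m = Suc m'\<close> step_sum_Suc step_sum_upd algebra_simps)
        ultimately show ?thesis using su last by linarith
      qed
    qed
    show ?thesis
    proof (cases "y m' \<le> x n'")
      case True
      show ?thesis
        by (rule swap[OF less.prems(1-4) _ True n' m' refl]) (use less in auto)
    next
      case False
      have "step_sum L R (\<lambda>t. - u t) n x (\<lambda>i. - c i) \<le> step_sum L R (\<lambda>t. - v t) m y (\<lambda>i. - d i)"
        by (rule swap[OF less.prems(3) step_values_uminus[OF less.prems(4)]
              less.prems(1) step_values_uminus[OF less.prems(2)] _ _ m' n' refl])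
          (use less False in \<open>auto simp: add.commute\<close>)
      then show ?thesis by (simp add: step_sum_uminus)
    qed
  qed
qed

section \<open>One-sided limits of nondecreasing functions\<close>

text \<open>By monotonicity the left limit is the supremum of \<alpha> over [a, c), which also
  identifies the value of \<open>Lim\<close>. At c = a the endpoint convention applies and no t
  qualifies.\<close>

lemma left_lim_bounds:
  assumes mono: "mono_on {a..b} \<alpha>" and c: "c \<in> {a..b}"
  shows "left_lim a \<alpha> c \<le> \<alpha> c" "\<And>t. \<lbrakk>a \<le> t; t < c\<rbrakk> \<Longrightarrow> \<alpha> t \<le> left_lim a \<alpha> c"
proof -
  have "left_lim a \<alpha> c \<le> \<alpha> c \<and> (\<forall>t. a \<le> t \<and> t < c \<longrightarrow> \<alpha> t \<le> left_lim a \<alpha> c)"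
  proof (cases "c = a")
    case False
    define l where "l = Sup (\<alpha> ` {a..<c})"
    have le: "\<alpha> s \<le> \<alpha> t" if "a \<le> s" "s \<le> t" "t \<le> b" for s t
      using mono that by (auto simp: mono_on_def)
    have bdd: "bdd_above (\<alpha> ` {a..<c})" using le c by (intro bdd_aboveI[of _ "\<alpha> c"]) auto
    have up: "\<alpha> t \<le> l" if "a \<le> t" "t < c" for t
      unfolding l_def using bdd that by (intro cSup_upper) auto
    have "l \<le> \<alpha> c" unfolding l_def using le c False by (intro cSup_least) auto
    moreover have "(\<alpha> \<longlongrightarrow> l) (at_left c)"
    proof (rule order_tendstoI)
      fix r assume "r < l"
      then obtain s where s: "a \<le> s" "s < c" "r < \<alpha> s"
        unfolding l_def using less_cSup_iff[OF _ bdd] c False by auto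
      have "\<forall>t\<in>{s<..<c}. r < \<alpha> t"
      proof
        fix t assume "t \<in> {s<..<c}"
        then show "r < \<alpha> t" using le[of s t] s c by simp
      qed
      then show "\<forall>\<^sub>F t in at_left c. r < \<alpha> t"
        using s eventually_at_left[OF s(2)] by (metis greaterThanLessThan_iff)
    next
      fix r assume "l < r"
      then have "\<forall>t\<in>{a<..<c}. \<alpha> t < r"
        using le_less_trans[OF up \<open>l < r\<close>] by simp
      moreover have "a < c" using c False by simp
      ultimately show "\<forall>\<^sub>F t in at_left c. \<alpha> t < r"
        using eventually_at_left[of a c] by (metis greaterThanLessThan_iff)
    qed
    then have "left_lim a \<alpha> c = l" using False by (simp add: left_lim_def tendsto_Lim)
    ultimately show ?thesis using up by simp
  qed (simp add: left_lim_def)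
  then show "left_lim a \<alpha> c \<le> \<alpha> c" "\<And>t. \<lbrakk>a \<le> t; t < c\<rbrakk> \<Longrightarrow> \<alpha> t \<le> left_lim a \<alpha> c" by auto
qed

lemma right_lim_bounds:
  assumes mono: "mono_on {a..b} \<alpha>" and c: "c \<in> {a..b}"
  shows "\<alpha> c \<le> right_lim b \<alpha> c" "\<And>t. \<lbrakk>c < t; t \<le> b\<rbrakk> \<Longrightarrow> right_lim b \<alpha> c \<le> \<alpha> t"
proof -
  have "\<alpha> c \<le> right_lim b \<alpha> c \<and> (\<forall>t. c < t \<and> t \<le> b \<longrightarrow> right_lim b \<alpha> c \<le> \<alpha> t)"
  proof (cases "c = b")
    case False
    define l where "l = Inf (\<alpha> ` {c<..b})"
    have le: "\<alpha> s \<le> \<alpha> t" if "a \<le> s" "s \<le> t" "t \<le> b" for s t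
      using mono that by (auto simp: mono_on_def)
    have bdd: "bdd_below (\<alpha> ` {c<..b})" using le c by (intro bdd_belowI[of _ "\<alpha> c"]) auto
    have low: "l \<le> \<alpha> t" if "c < t" "t \<le> b" for t
      unfolding l_def using bdd that by (intro cInf_lower) auto
    have "\<alpha> c \<le> l" unfolding l_def using le c False by (intro cInf_greatest) auto
    moreover have "(\<alpha> \<longlongrightarrow> l) (at_right c)"
    proof (rule order_tendstoI)
      fix r assume "l < r"
      then obtain s where s: "c < s" "s \<le> b" "\<alpha> s < r"
        unfolding l_def using cInf_less_iff[OF _ bdd] c False by auto
      have "\<forall>t\<in>{c<..<s}. \<alpha> t < r"
      proof
        fix t assume "t \<in> {c<..<s}"
        then show "\<alpha> t < r" using le[of t s] s c by simp
      qed
      then show "\<forall>\<^sub>F t in at_right c. \<alpha> t < r"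
        using s eventually_at_right[OF s(1)] by (metis greaterThanLessThan_iff)
    next
      fix r assume "r < l"
      then have "\<forall>t\<in>{c<..<b}. r < \<alpha> t"
        using less_le_trans[OF \<open>r < l\<close> low] by simp
      moreover have "c < b" using c False by simp
      ultimately show "\<forall>\<^sub>F t in at_right c. r < \<alpha> t"
        using eventually_at_right[of c b] by (metis greaterThanLessThan_iff)
    qed
    then have "right_lim b \<alpha> c = l" using False by (simp add: right_lim_def tendsto_Lim)
    ultimately show ?thesis using low by simp
  qed (simp add: right_lim_def)
  then show "\<alpha> c \<le> right_lim b \<alpha> c" "\<And>t. \<lbrakk>c < t; t \<le> b\<rbrakk> \<Longrightarrow> right_lim b \<alpha> c \<le> \<alpha> t" by auto
qed

lemma left_lim_le_right_lim:
  assumes "mono_on {a..b} \<alpha>" "a \<le> p" "p \<le> b"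
  shows "left_lim a \<alpha> p \<le> right_lim b \<alpha> p"
  using left_lim_bounds(1)[OF assms(1), of p] right_lim_bounds(1)[OF assms(1), of p] assms by simp

text \<open>The value of \<alpha> at any point between p and q separates the two limits. Thus open
  intervals have nonnegative weight.\<close>

lemma right_lim_le_left_lim:
  assumes "mono_on {a..b} \<alpha>" "a \<le> p" "p < q" "q \<le> b"
  shows "right_lim b \<alpha> p \<le> left_lim a \<alpha> q"
proof -
  obtain r where "p < r" "r < q" using dense[OF assms(3)] by blast
  then show ?thesis
    using right_lim_bounds(2)[OF assms(1), of p r] left_lim_bounds(2)[OF assms(1), of q r] assms
    by simp
qed

section \<open>Integrals of step functions\<close>

text \<open>There is one more point than there are open pieces, so the weight of the last point
  stays outside \<open>step_sum\<close>.\<close>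

lemma step_integral_eq_step_sum:
  "(\<Sum>i=0..n. u (x i) * mu_point a b \<alpha> (x i)) + (\<Sum>i=1..n. c i * mu_open a b \<alpha> (x (i - 1)) (x i))
    = step_sum (left_lim a \<alpha>) (right_lim b \<alpha>) u n x c + u (x n) * mu_point a b \<alpha> (x n)"
  by (induction n) (auto simp: step_sum_Suc step_sum_def mu_point_def mu_open_def)

lemma has_step_integral_iff:
  "has_step_integral a b \<alpha> u I \<longleftrightarrow>
    (\<exists>n x c. step_on_partition a b n x c u \<and>
      I = step_sum (left_lim a \<alpha>) (right_lim b \<alpha>) u n x c + u b * mu_point a b \<alpha> b)"
  unfolding has_step_integral_def step_integral_eq_step_sum
  by (auto simp: step_on_partition_def is_partition_def)

text \<open>Shows that no lower step integral exceeds an upper one, whatever partitions represent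
  them. \<open>step_sum_mono\<close> covers [a, b); the point b is compared separately.\<close>

lemma has_step_integral_mono:
  assumes "mono_on {a..b} \<alpha>" "a \<le> b" "has_step_integral a b \<alpha> v J" "has_step_integral a b \<alpha> u I"
    and le: "\<And>t. t \<in> {a..b} \<Longrightarrow> v t \<le> u t"
  shows "J \<le> I"
proof -
  obtain n x c where u: "step_on_partition a b n x c u"
    "I = step_sum (left_lim a \<alpha>) (right_lim b \<alpha>) u n x c + u b * mu_point a b \<alpha> b"
    using assms(4) unfolding has_step_integral_iff by blast
  obtain m y d where v: "step_on_partition a b m y d v"
    "J = step_sum (left_lim a \<alpha>) (right_lim b \<alpha>) v m y d + v b * mu_point a b \<alpha> b"
    using assms(3) unfolding has_step_integral_iff by blast
  have "step_sum (left_lim a \<alpha>) (right_lim b \<alpha>) v m y d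
      \<le> step_sum (left_lim a \<alpha>) (right_lim b \<alpha>) u n x c"
    using left_lim_le_right_lim[OF assms(1)] right_lim_le_left_lim[OF assms(1)] u v le
    by (intro step_sum_mono[of a b _ _ b])
      (auto simp: step_on_partition_def step_values_def)
  moreover have "v b * mu_point a b \<alpha> b \<le> u b * mu_point a b \<alpha> b"
    using le[of b] left_lim_le_right_lim[OF assms(1), of b] \<open>a \<le> b\<close>
    by (intro mult_right_mono) (auto simp: mu_point_def)
  ultimately show ?thesis using u v by simp
qed

text \<open>A single I serves all k, so the integrals of \<open>w - k\<close> and
  \<open>w + k\<close> differ by exactly \<open>2 * k * (\<alpha> b - \<alpha> a)\<close>.\<close>

lemma has_step_integral_shift:
  assumes "step_on_partition a b n x c w"
  obtains I where "\<And>k. has_step_integral a b \<alpha> (\<lambda>t. w t + k) (I + k * (\<alpha> b - \<alpha> a))"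
proof -
  define I where "I = step_sum (left_lim a \<alpha>) (right_lim b \<alpha>) w n x c + w b * mu_point a b \<alpha> b"
  have ends: "x 0 = a" "x n = b"
    using assms by (auto simp: step_on_partition_def is_partition_def)
  have "has_step_integral a b \<alpha> (\<lambda>t. w t + k) (I + k * (\<alpha> b - \<alpha> a))" for k
    unfolding has_step_integral_iff
  proof (intro exI conjI)
    show "step_on_partition a b n x (\<lambda>i. c i + k) (\<lambda>t. w t + k)"
      using assms by (rule step_on_partition_shift)
    show "I + k * (\<alpha> b - \<alpha> a) =
        step_sum (left_lim a \<alpha>) (right_lim b \<alpha>) (\<lambda>t. w t + k) n x (\<lambda>i. c i + k)
          + (w b + k) * mu_point a b \<alpha> b"
      \<comment> \<open>The telescoped sum reaches \<alpha>(b-), the point b adds the jump to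
        \<alpha>(b+), and the endpoint conventions turn the total into
        \<open>\<alpha> b - \<alpha> a\<close>.\<close>
      unfolding step_sum_shift ends I_def mu_point_def
      by (simp add: left_lim_def[of a \<alpha> a] right_lim_def[of b \<alpha> b] algebra_simps)
  qed
  then show ?thesis by (rule that)
qed

section \<open>Equality of lower and upper integrals\<close>

text \<open>Closeness for a single e makes both sets nonempty, and then each bounds the other, so
  \<open>Sup\<close> and \<open>Inf\<close> are genuine.\<close>

lemma Sup_eq_Inf_if_arbitrarily_close:
  fixes A B :: "real set"
  assumes le: "\<And>x y. \<lbrakk>x \<in> A; y \<in> B\<rbrakk> \<Longrightarrow> x \<le> y"
    and close: "\<And>e. e > 0 \<Longrightarrow> \<exists>x\<in>A. \<exists>y\<in>B. y - x \<le> e"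
  shows "Sup A = Inf B"
proof (rule antisym)
  obtain x0 y0 where xy: "x0 \<in> A" "y0 \<in> B" using close[of 1] by auto
  have bdd: "bdd_above A" "bdd_below B"
    using le xy by (meson bdd_aboveI, meson bdd_belowI)
  show "Sup A \<le> Inf B"
    using xy le by (intro cSup_least cInf_greatest) auto
  show "Inf B \<le> Sup A"
  proof (rule field_le_epsilon)
    fix e :: real assume "e > 0"
    then obtain x y where "x \<in> A" "y \<in> B" "y - x \<le> e" using close by blast
    then show "Inf B \<le> Sup A + e"
      using cSup_upper[of x A] cInf_lower[of y B] bdd by linarith
  qed
qed

lemma rds_integrable_incr_bounded_variation:
  assumes \<alpha>: "mono_on {a..b} \<alpha>" and "a \<le> b" and "bounded_variation_on a b f"
  shows "rds_integrable_incr a b \<alpha> f"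
proof -
  obtain V where V: "\<And>s t. \<lbrakk>a \<le> s; s \<le> t; t \<le> b\<rbrakk> \<Longrightarrow> \<bar>f t - f s\<bar> \<le> V t - V s"
    using bounded_variation_on_majorant[OF assms(3)] by blast
  have "\<bar>f t - f a\<bar> \<le> V b - V a" if "t \<in> {a..b}" for t
    using V[of a t] V[of t b] that by auto
  then have bdd: "bounded_fun_on a b f"
    by (intro bounded_fun_on_close[of a b "\<lambda>_. f a" f]) (auto simp: bounded_fun_on_def image_constant_conv)
  have D: "\<alpha> b - \<alpha> a \<ge> 0" using \<alpha> \<open>a \<le> b\<close> by (simp add: mono_on_def)
  have "lower_rds a b \<alpha> f = upper_rds a b \<alpha> f"
    unfolding lower_rds_def upper_rds_def
  proof (rule Sup_eq_Inf_if_arbitrarily_close, clarify)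
    fix J I v u
    assume "has_step_integral a b \<alpha> v J" "\<forall>t\<in>{a..b}. v t \<le> f t"
      "has_step_integral a b \<alpha> u I" "\<forall>t\<in>{a..b}. f t \<le> u t"
    then show "J \<le> I"
      using has_step_integral_mono[OF \<alpha> \<open>a \<le> b\<close>, of v J u I] by (meson order_trans)
  next
    fix e :: real assume "e > 0"
    \<comment> \<open>Chosen so that \<open>2 * k * (\<alpha> b - \<alpha> a) \<le> e\<close>; the
      summand 1 avoids division by zero for constant \<alpha>.\<close>
    define k where "k = e / (2 * (\<alpha> b - \<alpha> a + 1))"
    have "k > 0" using \<open>e > 0\<close> D by (simp add: k_def)
    obtain n x c w where w: "step_on_partition a b n x c w" "\<And>t. t \<in> {a..b} \<Longrightarrow> \<bar>w t - f t\<bar> \<le> k"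
      using step_on_partition_approx[OF V \<open>a \<le> b\<close> bdd \<open>k > 0\<close>] by blast
    obtain I where I: "\<And>k. has_step_integral a b \<alpha> (\<lambda>t. w t + k) (I + k * (\<alpha> b - \<alpha> a))"
      using has_step_integral_shift[OF w(1)] by blast
    have "\<forall>t\<in>{a..b}. w t + (- k) \<le> f t" "\<forall>t\<in>{a..b}. f t \<le> w t + k"
      using w(2) by (auto simp: abs_le_iff algebra_simps)
    moreover have "(I + k * (\<alpha> b - \<alpha> a)) - (I + (- k) * (\<alpha> b - \<alpha> a)) \<le> e"
    proof -
      have "2 * k * (\<alpha> b - \<alpha> a) \<le> 2 * k * (\<alpha> b - \<alpha> a + 1)"
        using \<open>k > 0\<close> by (intro mult_left_mono) auto
      also have "\<dots> = e" using D by (simp add: k_def field_simps)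
      finally show ?thesis by (simp add: algebra_simps)
    qed
    ultimately show "\<exists>x\<in>{I. \<exists>v. has_step_integral a b \<alpha> v I \<and> (\<forall>t\<in>{a..b}. v t \<le> f t)}.
        \<exists>y\<in>{I. \<exists>u. has_step_integral a b \<alpha> u I \<and> (\<forall>t\<in>{a..b}. f t \<le> u t)}. y - x \<le> e"
      using I[of k] I[of "- k"] by blast
  qed
  then show ?thesis using \<alpha> bdd by (simp add: rds_integrable_incr_def)
qed

theorem theorem7p5:
  fixes a b :: real and \<alpha> f :: "real \<Rightarrow> real"
  assumes "a < b"
    and "bounded_variation_on a b \<alpha>"
    and "bounded_variation_on a b f"
  shows "rds_integrable a b \<alpha> f"
proof -
  obtain V where V: "\<And>s t. \<lbrakk>a \<le> s; s \<le> t; t \<le> b\<rbrakk> \<Longrightarrow> \<bar>\<alpha> t - \<alpha> s\<bar> \<le> V t - V s"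
    using bounded_variation_on_majorant[OF assms(2)] by blast
  \<comment> \<open>V serves as the positive part and \<open>V - \<alpha>\<close> as the negative
    one, which is nondecreasing because
    \<open>\<alpha> t - \<alpha> s \<le> V t - V s\<close>.\<close>
  have "V s \<le> V t" "V s - \<alpha> s \<le> V t - \<alpha> t" if "a \<le> s" "s \<le> t" "t \<le> b" for s t
    using V[OF that] by linarith+
  then have "mono_on {a..b} V" "mono_on {a..b} (\<lambda>t. V t - \<alpha> t)"
    by (auto simp: mono_on_def)
  then show ?thesis
    unfolding rds_integrable_def
    using rds_integrable_incr_bounded_variation[OF _ less_imp_le[OF \<open>a < b\<close>] assms(3)]
    by (intro exI[of _ V] exI[of _ "\<lambda>t. V t - \<alpha> t"]) auto
qed

end
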